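(* Let $n\ge 1$ and $k\ge 0$. The number of permutations $\pi\in S_n$ for which the number of blocks $b(\pi)$ (defined below) equals $k$ is $n\cdot c(n-1,k)$, where $c(n-1,k)$ is the signless Stirling number of the first kind (the number of permutations of $n-1$ letters with exactly $k$ cycles).
   Context: For $\pi\in S_n$ written as a word $\pi(1)\cdots\pi(n)$, append the letter $n+1$ at the right and write the resulting word as $\pi_L\cdot 1\cdot \pi_R'$, where $\pi_L$ is the (possibly empty) subword to the left of the letter $1$ and $\pi_R'$ is the subword to the right of $1$ (which ends with $n+1$); let $\pi_R$ be $\pi_R'$ with the final letter $n+1$ removed. Decompose $\pi_L$ into consecutive blocks $\pi_L=\pi_1\cdot\pi_2\cdots\pi_l$ as follows: $\pi_1$ is the prefix of $\pi_L$ ending at the largest letter of $\pi_L$; $\pi_2$ is the prefix of the remaining word ending at its largest letter; and so on until $\pi_L$ is exhausted ($l=0$ if $\pi_L$ is empty). Then $b(\pi)=l$ if $\pi_R$ is empty and $b(\pi)=l+1$ if $\pi_R$ is nonempty (i.e. the blocks are $\pi_1,\dots,\pi_l$ and $\pi_R$, disregarding the singleton block consisting of the minimum element $1$). *)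

theory Defs
  imports "HOL-Combinatorics.Permutations" "HOL-Combinatorics.Stirling"
begin

(* Throughout, p is meant to be an element of S_n, i.e. p permutes {1..n}.  *)

definition ext_word :: "nat \<Rightarrow> (nat \<Rightarrow> nat) \<Rightarrow> nat list" where
  "ext_word n p = map p [1..<n + 1] @ [n + 1]"

definition left_part :: "nat \<Rightarrow> (nat \<Rightarrow> nat) \<Rightarrow> nat list" where
  "left_part n p = takeWhile (\<lambda>x. x \<noteq> 1) (ext_word n p)"

(* The word to the right of the letter 1, which ends with n + 1, without that final letter.  *)

definition right_part :: "nat \<Rightarrow> (nat \<Rightarrow> nat) \<Rightarrow> nat list" where
  "right_part n p = butlast (tl (dropWhile (\<lambda>x. x \<noteq> 1) (ext_word n p)))"

(* The prefix of a nonempty word w with distinct letters that ends at its largest letter.  *)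

definition max_prefix :: "nat list \<Rightarrow> nat list" where
  "max_prefix w = takeWhile (\<lambda>x. x \<noteq> Max (set w)) w @ [Max (set w)]"

function max_blocks :: "nat list \<Rightarrow> nat list list" where
  "max_blocks [] = []"
| "max_blocks (x # xs) =
     max_prefix (x # xs) # max_blocks (drop (length (max_prefix (x # xs))) (x # xs))"
  by pat_completeness auto
termination
  by (relation "measure length") (auto simp: max_prefix_def)

(* The singleton block consisting of the letter 1 is not counted.  *)

definition num_blocks :: "nat \<Rightarrow> (nat \<Rightarrow> nat) \<Rightarrow> nat" where
  "num_blocks n p =
     (let l = length (max_blocks (left_part n p))
      in if right_part n p = [] then l else l + 1)"

end

theory Submission
  imports Defs "HOL-Combinatorics.Multiset_Permutations"
begin

text \<open>
  Split a word of \<open>{1..n}\<close> at the letter 1 into a pair \<open>(u, v)\<close>, and let \<open>m = n - 1\<close>. The blocks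
  of \<open>u\<close> correspond to its right-to-left maxima, and removing the first letter shows that
  \<open>c(m, k)\<close> words have exactly \<open>k\<close> of them: a first letter starts a block of its
  own exactly if it is the largest letter. This settles the pairs with \<open>v\<close> empty. Let \<open>P(m, k)\<close> be the number of pairs with
  \<open>v\<close> nonempty and \<open>k\<close> blocks in total. Removing the last letter of \<open>v\<close>, which leaves \<open>v\<close> empty
  or not, gives \<open>P(m, k) = m * (c(m - 1, k - 1) + P(m - 1, k))\<close>, hence \<open>P(m, k) = m * c(m, k)\<close>
  by the recurrence of the Stirling numbers.
\<close>

text \<open>A leading maximum is a block by itself. Any other leading letter leaves the maximum in
  \<open>w\<close>, so it only lengthens the first block of \<open>w\<close> and the cut points stay
  where they are.\<close>

lemma length_max_blocks_Cons:
  "length (max_blocks (x # w)) =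
     (if x = Max (set (x # w)) then Suc (length (max_blocks w)) else length (max_blocks w))"
proof (cases "x = Max (set (x # w))")
  case True
  then have "max_prefix (x # w) = [x]"
    by (simp add: max_prefix_def)
  with True show ?thesis by simp
next
  case False
  then obtain y ys where w: "w = y # ys"
    by (cases w) auto
  with False have "Max (set (x # w)) = Max (set w)"
    by (auto simp: max_def split: if_splits)
  with False have "max_prefix (x # w) = x # max_prefix w"
    by (simp add: max_prefix_def)
  with False show ?thesis
    by (simp add: w)
qed

text \<open>From here on block counts are computed by removing a letter, so
  \<open>max_blocks (x # w)\<close> must stay folded.\<close>

declare max_blocks.simps(2) [simp del]

text \<open>Grouping the words by first letter reproduces the Stirling recurrence: the maximum
  contributes \<open>stirling m (k - 1)\<close> (nothing if \<open>k = 0\<close>), each of the other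
  \<open>m\<close> letters \<open>stirling m k\<close>.\<close>

lemma card_permutations_of_set_max_blocks:
  assumes "finite A"
  shows "card {w \<in> permutations_of_set A. length (max_blocks w) = k} = stirling (card A) k"
  using assms
proof (induction "card A" arbitrary: A k)
  case 0
  then show ?case by (cases k) (auto intro: card_eq_0_iff[THEN iffD2] simp: Collect_conv_if)
next
  case (Suc m)
  let ?S = "\<lambda>x. {w \<in> permutations_of_set (A - {x}). length (max_blocks (x # w)) = k}"
  from Suc have "A \<noteq> {}" by auto
  define M where "M = Max A"
  have M: "M \<in> A"
    using \<open>A \<noteq> {}\<close> \<open>finite A\<close> by (simp add: M_def)
  have IH: "card {w \<in> permutations_of_set (A - {x}). length (max_blocks w) = j} = stirling m j"
    if "x \<in> A" for x j
    using Suc.hyps(1)[of "A - {x}" j] Suc.prems that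
    by (simp flip: Suc.hyps(2))
  have blocks: "length (max_blocks (x # w)) =
      (if x = M then Suc (length (max_blocks w)) else length (max_blocks w))"
    if "w \<in> permutations_of_set (A - {x})" "x \<in> A" for x w
  proof -
    have "set (x # w) = A"
      using that by (auto simp: permutations_of_set_def)
    then show ?thesis
      unfolding length_max_blocks_Cons M_def by simp
  qed
  have not_Max: "card (?S x) = stirling m k" if "x \<in> A - {M}" for x
  proof -
    have "?S x = {w \<in> permutations_of_set (A - {x}). length (max_blocks w) = k}"
      using that by (auto simp: blocks)
    then show ?thesis
      using IH[of x k] that by simp
  qed
  have Max: "card (?S M) = (case k of 0 \<Rightarrow> 0 | Suc k' \<Rightarrow> stirling m k')"
  proof (cases k)
    case 0
    then show ?thesis using M by (simp add: blocks cong: conj_cong)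
  next
    case (Suc k')
    have "?S M = {w \<in> permutations_of_set (A - {M}). length (max_blocks w) = k'}"
      using M Suc by (auto simp: blocks)
    then show ?thesis
      using IH[OF M, of k'] Suc by simp
  qed
  have "{w \<in> permutations_of_set A. length (max_blocks w) = k} = (\<Union>x\<in>A. (#) x ` ?S x)"
    using \<open>A \<noteq> {}\<close> by (subst permutations_of_set_nonempty) auto
  also have "card \<dots> = (\<Sum>x\<in>A. card ((#) x ` ?S x))"
    using \<open>finite A\<close> by (intro card_UN_disjoint) auto
  also have "\<dots> = (\<Sum>x\<in>A. card (?S x))"
    by (simp add: card_image)
  also have "\<dots> = card (?S M) + (\<Sum>x\<in>A - {M}. card (?S x))"
    using M \<open>finite A\<close> by (rule sum.remove[rotated])
  also have "\<dots> = card (?S M) + m * stirling m k"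
    using not_Max M by (simp flip: Suc.hyps(2))
  \<comment> \<open>For \<open>k = 0\<close> both sides vanish; \<open>m * stirling m 0\<close> is 0
    by its first factor if \<open>m = 0\<close> and by its second otherwise.\<close>
  also have "\<dots> = stirling (Suc m) k"
    unfolding Max by (cases k; cases m) auto
  finally show ?case
    using Suc by simp
qed

text \<open>A split is determined by the word and the position of the cut.\<close>

lemma finite_splits:
  assumes "finite W"
  shows "finite {(u, v). u @ v \<in> W}"
proof (rule finite_subset)
  show "{(u, v). u @ v \<in> W} \<subseteq> (\<Union>w\<in>W. (\<lambda>i. (take i w, drop i w)) ` {..length w})"
  proof
    fix z
    assume "z \<in> {(u, v). u @ v \<in> W}"
    then obtain u v where "z = (u, v)" "u @ v \<in> W"
      by auto
    then show "z \<in> (\<Union>w\<in>W. (\<lambda>i. (take i w, drop i w)) ` {..length w})"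
      by (intro UN_I[of "u @ v"] image_eqI[of _ _ "length u"]) auto
  qed
qed (use assms in auto)

text \<open>Here \<open>k\<close> counts the blocks of \<open>u\<close> alone; the nonempty
  \<open>v\<close> is one more block, whence \<open>Suc k\<close>. The induction removes the last
  letter of \<open>v\<close>, which does not touch \<open>u\<close>.\<close>

lemma card_split_permutations_max_blocks:
  assumes "finite A"
  shows "card {(u, v). u @ v \<in> permutations_of_set A \<and> v \<noteq> [] \<and> length (max_blocks u) = k} =
    card A * stirling (card A) (Suc k)"
  using assms
proof (induction "card A" arbitrary: A)
  case 0
  then show ?case by (auto simp: permutations_of_set_def intro: card_eq_0_iff[THEN iffD2])
next
  case (Suc m)
  define U where "U = (\<lambda>A. {u \<in> permutations_of_set A. length (max_blocks u) = k})"
  define P where "P = (\<lambda>A. {(u, v). u @ v \<in> permutations_of_set A \<and> v \<noteq> [] \<and>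
    length (max_blocks u) = k})"
  define f :: "nat \<Rightarrow> nat list \<times> nat list \<Rightarrow> nat list \<times> nat list"
    where "f = (\<lambda>x (u, v). (u, v @ [x]))"
  \<comment> \<open>The pairs left after removing a last letter \<open>x\<close>: either
    \<open>v\<close> was just \<open>[x]\<close>, or a nonempty \<open>v\<close> remains.\<close>
  let ?R = "\<lambda>x. (\<lambda>u. (u, [])) ` U (A - {x}) \<union> P (A - {x})"
  have IH: "card (P (A - {x})) = m * stirling m (Suc k)" if "x \<in> A" for x
    using Suc.hyps(1)[of "A - {x}"] Suc.prems that unfolding P_def
    by (simp flip: Suc.hyps(2))
  have card_U: "card (U (A - {x})) = stirling m k" if "x \<in> A" for x
    using card_permutations_of_set_max_blocks[of "A - {x}" k] Suc.prems that unfolding U_def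
    by (simp flip: Suc.hyps(2))
  have fin: "finite (U B)" "finite (P B)" for B
  proof -
    show "finite (U B)"
      by (simp add: U_def)
    show "finite (P B)"
      by (rule finite_subset[OF _ finite_splits[of "permutations_of_set B"]]) (auto simp: P_def)
  qed
  have "P A = (\<Union>x\<in>A. f x ` ?R x)"
  proof (intro equalityI subsetI)
    fix z
    assume "z \<in> P A"
    then obtain u v x where z: "z = (u, v @ [x])" "u @ v @ [x] \<in> permutations_of_set A"
        "length (max_blocks u) = k"
      unfolding P_def by clarify (metis rev_exhaust)
    then have "x \<in> A" "u @ v \<in> permutations_of_set (A - {x})"
      by (auto simp: permutations_of_set_def)
    moreover from this z have "(u, v) \<in> ?R x"
      by (cases "v = []") (auto simp: P_def U_def)
    moreover have "z = f x (u, v)"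
      by (simp add: f_def z(1))
    ultimately show "z \<in> (\<Union>x\<in>A. f x ` ?R x)"
      by blast
  next
    fix z
    assume "z \<in> (\<Union>x\<in>A. f x ` ?R x)"
    then obtain x u v where "x \<in> A" "(u, v) \<in> ?R x" and z: "z = (u, v @ [x])"
      by (auto simp: f_def)
    then have uv: "u @ v \<in> permutations_of_set (A - {x})" "length (max_blocks u) = k"
      by (auto simp: P_def U_def)
    then have "set (u @ v @ [x]) = insert x (A - {x})" "distinct (u @ v @ [x])"
      by (auto simp: permutations_of_set_def)
    then have "u @ v @ [x] \<in> permutations_of_set A"
      using \<open>x \<in> A\<close> by (simp only: permutations_of_set_def insert_Diff) simp
    then show "z \<in> P A"
      using uv by (simp add: P_def z)
  qed
  \<comment> \<open>The images are disjoint because \<open>x\<close> can be read off as the last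
    letter.\<close>
  also have "card \<dots> = (\<Sum>x\<in>A. card (f x ` ?R x))"
    using fin \<open>finite A\<close> by (intro card_UN_disjoint) (auto simp: f_def)
  also have "\<dots> = (\<Sum>x\<in>A. card (?R x))"
    by (intro sum.cong refl card_image) (auto simp: f_def inj_on_def)
  also have "\<dots> = (\<Sum>x\<in>A. card (U (A - {x})) + card (P (A - {x})))"
  proof (intro sum.cong refl)
    fix x
    have "card (?R x) = card ((\<lambda>u. (u, [] :: nat list)) ` U (A - {x})) + card (P (A - {x}))"
      using fin by (intro card_Un_disjoint) (auto simp: P_def)
    also have "card ((\<lambda>u. (u, [] :: nat list)) ` U (A - {x})) = card (U (A - {x}))"
      by (intro card_image) (auto simp: inj_on_def)
    finally show "card (?R x) = card (U (A - {x})) + card (P (A - {x}))" .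
  qed
  also have "\<dots> = (\<Sum>x\<in>A. stirling m k + m * stirling m (Suc k))"
    by (simp add: IH card_U)
  \<comment> \<open>The constant summand is the recurrence for
    \<open>stirling (Suc m) (Suc k)\<close>.\<close>
  also have "\<dots> = card A * stirling (card A) (Suc k)"
    using Suc.hyps(2)[symmetric] by simp
  finally show ?case
    unfolding P_def .
qed

text \<open>Injective because a permutation is the identity off \<open>set xs\<close>; surjective
  because both sides have the same finite cardinality.\<close>

lemma bij_betw_map_permutes:
  assumes "distinct xs"
  shows "bij_betw (\<lambda>p. map p xs) {p. p permutes set xs} (permutations_of_set (set xs))"
proof -
  have inj: "inj_on (\<lambda>p. map p xs) {p. p permutes set xs}"
  proof (rule inj_onI, rule ext)
    fix p q x
    assume "p \<in> {p. p permutes set xs}" "q \<in> {p. p permutes set xs}" "map p xs = map q xs"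
    then show "p x = q x"
      by (cases "x \<in> set xs") (simp_all add: permutes_not_in)
  qed
  have "(\<lambda>p. map p xs) ` {p. p permutes set xs} = permutations_of_set (set xs)"
  proof (rule card_subset_eq)
    show "(\<lambda>p. map p xs) ` {p. p permutes set xs} \<subseteq> permutations_of_set (set xs)"
    proof (intro subsetI permutations_of_setI; elim imageE CollectE; hypsubst)
      fix p
      assume p: "p permutes set xs"
      show "set (map p xs) = set xs"
        using permutes_image[OF p] by simp
      show "distinct (map p xs)"
        using assms permutes_inj_on[OF p] by (simp add: distinct_map)
    qed
    show "card ((\<lambda>p. map p xs) ` {p. p permutes set xs}) = card (permutations_of_set (set xs))"
      using inj by (simp add: card_image card_permutations)
  qed simp
  with inj show ?thesis
    by (simp add: bij_betw_def)
qed

theorem theorem4p3: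
  fixes n k :: nat
  assumes "n \<ge> 1"
  shows "card {p. p permutes {1..n} \<and> num_blocks n p = k} = n * stirling (n - 1) k"
proof -
  define A where "A = {2..n}"
  define h where "h = (\<lambda>u (v :: nat list). length (max_blocks u) + (if v = [] then 0 else 1 :: nat))"
  define E where "E = {(u, v). u @ v \<in> permutations_of_set A \<and> h u v = k}"
  define S where "S = {p. p permutes {1..n} \<and> num_blocks n p = k}"
  define xs where "xs = [1..<n + 1]"
  \<comment> \<open>The letter 1 marks the cut, so pairs use only the \<open>n - 1\<close> letters
    of \<open>A\<close>.\<close>
  define g :: "nat list \<times> nat list \<Rightarrow> nat list" where "g = (\<lambda>(u, v). u @ 1 # v)"
  have xs: "distinct xs" "set xs = {1..n}"
    by (auto simp: xs_def)
  have ins: "insert 1 A = {1..n}" "1 \<notin> A" "finite A" and card_A: "card A = n - 1"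
    using assms by (auto simp: A_def)
  have blocks: "num_blocks n p = h u v" if "map p xs = u @ 1 # v" "1 \<notin> set u" for p u v
  proof -
    \<comment> \<open>The appended \<open>n + 1\<close> is exactly the letter that
      \<open>butlast\<close> in \<open>right_part\<close> removes, which leaves
      \<open>v\<close>.\<close>
    have w: "ext_word n p = u @ 1 # v @ [n + 1]"
      using that by (simp add: ext_word_def xs_def)
    have not_1: "x \<noteq> 1" if "x \<in> set u" for x
      using that \<open>1 \<notin> set u\<close> by blast
    have "left_part n p = u" "right_part n p = v"
      unfolding left_part_def right_part_def w
      using not_1 by (auto simp: dropWhile_append2 takeWhile_append2 butlast_append)
    then show ?thesis
      by (simp add: num_blocks_def h_def)
  qed
  have "(\<lambda>p. map p xs) ` S = g ` E"
  proof (intro equalityI subsetI)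
    fix w
    assume "w \<in> (\<lambda>p. map p xs) ` S"
    then obtain p where p: "p permutes {1..n}" "num_blocks n p = k" "w = map p xs"
      by (auto simp: S_def)
    then have w: "set w = {1..n}" "distinct w"
      using bij_betw_apply[OF bij_betw_map_permutes[OF xs(1)], of p] xs(2)
      by (auto simp: permutations_of_set_def)
    then have "1 \<in> set w"
      using assms by auto
    then obtain u v where uv: "w = u @ 1 # v" "1 \<notin> set u"
      using split_list_first by metis
    have "insert 1 (set (u @ v)) = insert 1 A" "1 \<notin> set (u @ v)"
      using w uv ins(1) by auto
    then have "set (u @ v) = A"
      using ins(2) insert_ident by metis
    then have "(u, v) \<in> E"
      using w(2) p(2) blocks[of p u v] uv p(3)
      unfolding E_def permutations_of_set_def by simp
    then show "w \<in> g ` E"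
      by (rule rev_image_eqI) (simp add: g_def uv(1))
  next
    fix w
    assume "w \<in> g ` E"
    then obtain u v where uv: "w = u @ 1 # v" "u @ v \<in> permutations_of_set A" "h u v = k"
      by (auto simp: g_def E_def)
    then have "set (u @ v) = A" "distinct (u @ v)"
      by (auto simp: permutations_of_set_def)
    then have "w \<in> permutations_of_set (insert 1 A)" and "1 \<notin> set u"
      using ins(2) uv(1) by (auto simp: permutations_of_set_def)
    then have "w \<in> (\<lambda>p. map p xs) ` {p. p permutes {1..n}}"
      using bij_betw_imp_surj_on[OF bij_betw_map_permutes[OF xs(1)]] xs(2) ins(1) by simp
    then show "w \<in> (\<lambda>p. map p xs) ` S"
      using uv blocks[of _ u v] \<open>1 \<notin> set u\<close> by (auto simp: S_def)
  qed
  moreover have "inj_on (\<lambda>p. map p xs) S"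
    using bij_betw_imp_inj_on[OF bij_betw_map_permutes[OF xs(1)]] xs(2)
    by (auto intro: inj_on_subset simp: S_def)
  \<comment> \<open>Neither half contains 1, so its only occurrence recovers the cut.\<close>
  moreover have "inj_on g E"
  proof (rule inj_onI)
    fix y z
    assume yz: "y \<in> E" "z \<in> E" "g y = g z"
    obtain u v u' v' where "y = (u, v)" "z = (u', v')"
      by (cases y, cases z)
    moreover have "1 \<notin> set u" "1 \<notin> set v" "1 \<notin> set u'" "1 \<notin> set v'"
      using yz ins(2) calculation by (auto simp: E_def permutations_of_set_def)
    ultimately show "y = z"
      using yz(3) append_Cons_eq_iff[of 1 u v u' v'] by (auto simp: g_def)
  qed
  ultimately have "card S = card E"
    by (metis card_image)
  also have "card E = n * stirling (n - 1) k"
  proof -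
    let ?U = "{u \<in> permutations_of_set A. length (max_blocks u) = k}"
    let ?P = "{(u, v). u @ v \<in> permutations_of_set A \<and> v \<noteq> [] \<and> Suc (length (max_blocks u)) = k}"
    have E: "E = (\<lambda>u. (u, [])) ` ?U \<union> ?P"
      by (auto simp: E_def h_def split: if_splits)
    have disjoint: "(\<lambda>u. (u, [])) ` ?U \<inter> ?P = {}"
      by auto
    have "card ((\<lambda>u. (u, [] :: nat list)) ` ?U) = stirling (n - 1) k"
      using card_permutations_of_set_max_blocks[OF ins(3), of k] card_A
      by (subst card_image) (auto simp: inj_on_def)
    moreover have "card ?P = (n - 1) * stirling (n - 1) k"
    proof (cases k)
      \<comment> \<open>A nonempty \<open>v\<close> forces at least one block, so \<open>?P\<close>
        is empty; the right side is 0 whether or not \<open>n - 1\<close> is 0.\<close>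
      case 0
      then show ?thesis by (cases "n - 1") auto
    next
      case (Suc k')
      then show ?thesis
        using card_split_permutations_max_blocks[OF ins(3), of k'] card_A by simp
    qed
    moreover have "finite ?P"
      by (rule finite_subset[OF _ finite_splits[of "permutations_of_set A"]]) auto
    ultimately have "card E = stirling (n - 1) k + (n - 1) * stirling (n - 1) k"
      by (simp add: E card_Un_disjoint disjoint)
    also have "\<dots> = n * stirling (n - 1) k"
      using assms by (cases n) auto
    finally show ?thesis .
  qed
  finally show ?thesis
    unfolding S_def .
qed

end
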